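(* Let $K$ be a field, let $U\subseteq \mathbb{A}_K^n$ and $V\subseteq \mathbb{A}_K^m$ be nonempty Zariski-open subsets, and let $f:U\to \mathbb{A}_K^m$ and $g:V\to\mathbb{A}_K^l$ be morphisms of algebraic varieties over $K$ with $f(U)\subseteq V$, given by tuples of rational functions $\boldsymbol f=(f_1(x_1,\dots,x_n),\dots,f_m(x_1,\dots,x_n))$ with $f_j\in\Gamma(U,\mathcal O_U)$ and $\boldsymbol g=(g_1(y_1,\dots,y_m),\dots,g_l(y_1,\dots,y_m))$ with $g_i\in\Gamma(V,\mathcal O_V)$. Let $\theta_{\boldsymbol x}$ be the $n$-variate higher derivation with respect to $\boldsymbol x=(x_1,\dots,x_n)$ on $\Gamma(U,\mathcal O_U)\subseteq K(x_1,\dots,x_n)$ and $\theta_{\boldsymbol y}$ the $m$-variate higher derivation with respect to $\boldsymbol y=(y_1,\dots,y_m)$ on $\Gamma(V,\mathcal O_V)\subseteq K(y_1,\dots,y_m)$. Then, in $\Gamma(U,\mathcal O_U)[[T_1,\dots,T_n]]^l$, $$\theta_{\boldsymbol x}(g\circ f)=\bigl(\theta_{\boldsymbol y}(g)|_{\boldsymbol y=\boldsymbol f}\bigr)\big|_{\boldsymbol T=\theta_{\boldsymbol x}(\boldsymbol f)-\boldsymbol f}=\sum_{\boldsymbol\mu\in\mathbb N^m}\theta_{\boldsymbol y}^{(\boldsymbol\mu)}(g)|_{\boldsymbol y=\boldsymbol f}\cdot\prod_{j=1}^m\Bigl(\sum_{\boldsymbol\nu\in\mathbb N^n,\ \boldsymbol\nu\neq\boldsymbol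 0}\theta_{\boldsymbol x}^{(\boldsymbol\nu)}(f_j)\,\boldsymbol T^{\boldsymbol\nu}\Bigr)^{\mu_j}.$$
   Context: $\mathbb N$ contains $0$; multi-index notation is used, $\boldsymbol T^{\boldsymbol\nu}=T_1^{\nu_1}\cdots T_n^{\nu_n}$. A $d$-variate higher derivation on a commutative ring $R$ is a ring homomorphism $\theta:R\to R[[T_1,\dots,T_d]]$ with $\theta(r)|_{\boldsymbol T=\boldsymbol 0}=r$ for all $r\in R$; $\theta^{(\boldsymbol\alpha)}(r)$ denotes the coefficient of $\boldsymbol T^{\boldsymbol\alpha}$ in $\theta(r)$. On $K[x_1,\dots,x_n]$, $\theta_{\boldsymbol x}$ is the $n$-variate higher derivation which is the $K$-algebra homomorphism $K[\boldsymbol x]\to K[\boldsymbol x][[T_1,\dots,T_n]]$ with $\theta_{\boldsymbol x}(x_i)=x_i+T_i$. Since $\Gamma(U,\mathcal O_U)$ is a localization of $K[\boldsymbol x]$, hence étale over it, $\theta_{\boldsymbol x}$ extends uniquely to an $n$-variate higher derivation on $\Gamma(U,\mathcal O_U)$, also denoted $\theta_{\boldsymbol x}$. Similarly for $\theta_{\boldsymbol y}:\Gamma(V,\mathcal O_V)\to\Gamma(V,\mathcal O_V)[[T_1,\dots,T_m]]$, with $\theta_{\boldsymbol y}(y_j)=y_j+T_j$. Application of higher derivations to a vector is componentwise: $\theta_{\boldsymbol x}(\boldsymbol f)=(\theta_{\boldsymbol x}(f_1),\dots,\theta_{\boldsymbol x}(f_m))$, and likewise for $g$ and $g\circ f$.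 The notation $|_{\boldsymbol y=\boldsymbol f}$ means pulling back functions on $V$ along $f$, i.e. substituting $y_j\mapsto f_j$ (applied coefficientwise to power series in $\boldsymbol T$). The notation $|_{\boldsymbol T=\theta_{\boldsymbol x}(\boldsymbol f)-\boldsymbol f}$ means substituting, for the $m$ variables $T_1,\dots,T_m$ of the power series ring belonging to $\theta_{\boldsymbol y}$, the power series $\theta_{\boldsymbol x}(f_j)-f_j\in\Gamma(U,\mathcal O_U)[[T_1,\dots,T_n]]$, which have zero constant term. *)

theory Defs
  imports
    "HOL-Library.Poly_Mapping"
    "HOL-Computational_Algebra.Polynomial_Factorial"
    "HOL-Algebra.Algebraic_Closure_Type"
begin

section \<open>Formal power series in several variables\<close>

typedef ('v, 'a) mps = "UNIV :: (('v \<Rightarrow>\<^sub>0 nat) \<Rightarrow> 'a) set"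
  morphisms mps_coeff Abs_mps ..

setup_lifting type_definition_mps

lemma mps_eqI: "(\<And>\<alpha>. mps_coeff F \<alpha> = mps_coeff G \<alpha>) \<Longrightarrow> F = G"
  by transfer auto

lemma finite_antidiagonal:
  fixes \<alpha> :: "'v \<Rightarrow>\<^sub>0 nat"
  shows "finite {(\<beta>, \<gamma>). \<beta> + \<gamma> = \<alpha>}"
proof -
  let ?A = "Poly_Mapping.keys \<alpha>" and ?m = "\<Sum>x\<in>Poly_Mapping.keys \<alpha>. Poly_Mapping.lookup \<alpha> x"
  let ?H = "{h. \<forall>x. (x \<in> ?A \<longrightarrow> h x \<in> {..?m}) \<and> (x \<notin> ?A \<longrightarrow> h x = 0)}"
  have fin: "finite ?H"
    by (rule finite_set_of_finite_funs) auto
  have mem: "Poly_Mapping.lookup \<beta> \<in> ?H" if "\<beta> + \<gamma> = \<alpha>" for \<beta> \<gamma>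
  proof -
    have le: "Poly_Mapping.lookup \<beta> x \<le> Poly_Mapping.lookup \<alpha> x" for x
      unfolding that[symmetric] by (simp add: lookup_add)
    have "Poly_Mapping.lookup \<beta> x \<le> ?m" if "x \<in> ?A" for x
      using le[of x] member_le_sum[OF that, of "Poly_Mapping.lookup \<alpha>"] by simp
    moreover have "Poly_Mapping.lookup \<beta> x = 0" if "x \<notin> ?A" for x
      using le[of x] that by (simp add: in_keys_iff)
    ultimately show ?thesis
      by simp
  qed
  have "Poly_Mapping.lookup ` {\<beta>. \<exists>\<gamma>. \<beta> + \<gamma> = \<alpha>} \<subseteq> ?H"
  proof (rule image_subsetI, elim CollectE exE)
    fix \<beta> \<gamma>
    assume "\<beta> + \<gamma> = \<alpha>"
    then show "Poly_Mapping.lookup \<beta> \<in> ?H"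
      by (rule mem)
  qed
  then have "finite (Poly_Mapping.lookup ` {\<beta>. \<exists>\<gamma>. \<beta> + \<gamma> = \<alpha>})"
    by (rule finite_subset[OF _ fin])
  then have "finite {\<beta>. \<exists>\<gamma>. \<beta> + \<gamma> = \<alpha>}"
    by (rule finite_imageD) (simp add: inj_on_def)
  moreover have "{(\<beta>, \<gamma>). \<beta> + \<gamma> = \<alpha>} \<subseteq> (\<lambda>\<beta>. (\<beta>, \<alpha> - \<beta>)) ` {\<beta>. \<exists>\<gamma>. \<beta> + \<gamma> = \<alpha>}"
    by force
  ultimately show ?thesis
    by (meson finite_imageI finite_subset)
qed

instantiation mps :: (type, comm_ring_1) comm_ring_1
begin

lift_definition zero_mps :: "('a, 'b) mps" is "\<lambda>_. 0" .
lift_definition one_mps :: "('a, 'b) mps" is "\<lambda>\<alpha>. if \<alpha> = 0 then 1 else 0" .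
lift_definition plus_mps :: "('a, 'b) mps \<Rightarrow> ('a, 'b) mps \<Rightarrow> ('a, 'b) mps"
  is "\<lambda>F G \<alpha>. F \<alpha> + G \<alpha>" .
lift_definition minus_mps :: "('a, 'b) mps \<Rightarrow> ('a, 'b) mps \<Rightarrow> ('a, 'b) mps"
  is "\<lambda>F G \<alpha>. F \<alpha> - G \<alpha>" .
lift_definition uminus_mps :: "('a, 'b) mps \<Rightarrow> ('a, 'b) mps" is "\<lambda>F \<alpha>. - F \<alpha>" .
lift_definition times_mps :: "('a, 'b) mps \<Rightarrow> ('a, 'b) mps \<Rightarrow> ('a, 'b) mps"
  is "\<lambda>F G \<alpha>. \<Sum>(\<beta>, \<gamma>) | \<beta> + \<gamma> = \<alpha>. F \<beta> * G \<gamma>" .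

instance
proof
  fix F G H :: "('a, 'b) mps"
  show "F * G * H = F * (G * H)"
  proof (transfer, rule ext)
    fix F G H :: "('a \<Rightarrow>\<^sub>0 nat) \<Rightarrow> 'b" and \<alpha> :: "'a \<Rightarrow>\<^sub>0 nat"
    let ?D = "\<lambda>\<alpha> :: 'a \<Rightarrow>\<^sub>0 nat. {(\<beta>, \<gamma>). \<beta> + \<gamma> = \<alpha>}"
    have "(\<Sum>(\<beta>, \<gamma>) \<in> ?D \<alpha>. (\<Sum>(\<delta>, \<epsilon>) \<in> ?D \<beta>. F \<delta> * G \<epsilon>) * H \<gamma>) =
        (\<Sum>x \<in> ?D \<alpha>. \<Sum>y \<in> ?D (fst x). F (fst y) * G (snd y) * H (snd x))"
      by (simp add: case_prod_unfold sum_distrib_right)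
    also have "\<dots> = (\<Sum>(x, y) \<in> Sigma (?D \<alpha>) (\<lambda>x. ?D (fst x)). F (fst y) * G (snd y) * H (snd x))"
      by (rule sum.Sigma) (auto simp: finite_antidiagonal)
    also have "\<dots> = (\<Sum>(x, y) \<in> Sigma (?D \<alpha>) (\<lambda>x. ?D (snd x)). F (fst x) * (G (fst y) * H (snd y)))"
      by (rule sum.reindex_bij_witness
          [of _ "\<lambda>(x, y). ((fst x + fst y, snd y), (fst x, fst y))"
                "\<lambda>(x, y). ((fst y, snd y + snd x), (snd y, snd x))"])
        (auto simp: algebra_simps)
    also have "\<dots> = (\<Sum>x \<in> ?D \<alpha>. \<Sum>y \<in> ?D (snd x). F (fst x) * (G (fst y) * H (snd y)))"
      by (rule sum.Sigma[symmetric]) (auto simp: finite_antidiagonal)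
    also have "\<dots> = (\<Sum>(\<beta>, \<gamma>) \<in> ?D \<alpha>. F \<beta> * (\<Sum>(\<delta>, \<epsilon>) \<in> ?D \<gamma>. G \<delta> * H \<epsilon>))"
      by (simp add: case_prod_unfold sum_distrib_left)
    finally show "(\<Sum>(\<beta>, \<gamma>) \<in> ?D \<alpha>. (\<Sum>(\<delta>, \<epsilon>) \<in> ?D \<beta>. F \<delta> * G \<epsilon>) * H \<gamma>) =
        (\<Sum>(\<beta>, \<gamma>) \<in> ?D \<alpha>. F \<beta> * (\<Sum>(\<delta>, \<epsilon>) \<in> ?D \<gamma>. G \<delta> * H \<epsilon>))" .
  qed
  show "F * G = G * F"
    by (transfer, rule ext, rule sum.reindex_bij_witness[of _ prod.swap prod.swap])
      (auto simp: algebra_simps)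
  show "1 * F = F"
  proof (transfer, rule ext)
    fix F :: "('a \<Rightarrow>\<^sub>0 nat) \<Rightarrow> 'b" and \<alpha> :: "'a \<Rightarrow>\<^sub>0 nat"
    have "(\<Sum>(\<beta>, \<gamma>) \<in> {(0 :: 'a \<Rightarrow>\<^sub>0 nat, \<alpha>)}. (if \<beta> = 0 then 1 else 0) * F \<gamma>) =
        (\<Sum>(\<beta>, \<gamma>) | \<beta> + \<gamma> = \<alpha>. (if \<beta> = 0 then 1 else 0) * F \<gamma>)"
      by (rule sum.mono_neutral_left) (auto simp: finite_antidiagonal split: if_splits)
    then show "(\<Sum>(\<beta>, \<gamma>) | \<beta> + \<gamma> = \<alpha>. (if \<beta> = 0 then 1 else 0) * F \<gamma>) = F \<alpha>"
      by simp
  qed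
  show "(F + G) * H = F * H + G * H"
    by transfer (simp add: case_prod_unfold distrib_right sum.distrib)
  show "F + G + H = F + (G + H)" "F + G = G + F" "0 + F = F" "- F + F = 0" "F - G = F + - G"
    by (transfer, simp add: algebra_simps)+
  show "(0 :: ('a, 'b) mps) \<noteq> 1"
    by transfer (metis zero_neq_one)
qed

end

definition mps_const :: "'a::zero \<Rightarrow> ('v, 'a) mps"
  where "mps_const c = Abs_mps (\<lambda>\<alpha>. if \<alpha> = 0 then c else 0)"

definition mps_monom :: "('v \<Rightarrow>\<^sub>0 nat) \<Rightarrow> 'a::zero \<Rightarrow> ('v, 'a) mps"
  where "mps_monom \<nu> c = Abs_mps (\<lambda>\<alpha>. if \<alpha> = \<nu> then c else 0)"

definition mps_var :: "'v \<Rightarrow> ('v, 'a::zero_neq_one) mps"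
  where "mps_var i = mps_monom (Poly_Mapping.single i 1) 1"

definition mps_map :: "('a \<Rightarrow> 'b) \<Rightarrow> ('v, 'a) mps \<Rightarrow> ('v, 'b) mps"
  where "mps_map h F = Abs_mps (\<lambda>\<alpha>. h (mps_coeff F \<alpha>))"

definition mps_over :: "'a set \<Rightarrow> ('v, 'a) mps set"
  where "mps_over R = {F. \<forall>\<alpha>. mps_coeff F \<alpha> \<in> R}"

text \<open>
  Infinite sums of power series, in the usual sense: a family is summable if every monomial
  occurs in only finitely many of its members, and the sum is then formed coefficientwise. The
  value of \<open>mps_infsum\<close> is meaningful only for summable families.
\<close>

definition mps_summable_on :: "('i \<Rightarrow> ('v, 'a::comm_monoid_add) mps) \<Rightarrow> 'i set \<Rightarrow> bool"
  where "mps_summable_on F I \<longleftrightarrow> (\<forall>\<alpha>. finite {i \<in> I. mps_coeff (F i) \<alpha> \<noteq> 0})"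

definition mps_infsum :: "('i \<Rightarrow> ('v, 'a::comm_monoid_add) mps) \<Rightarrow> 'i set \<Rightarrow> ('v, 'a) mps"
  where "mps_infsum F I =
    Abs_mps (\<lambda>\<alpha>. \<Sum>i | i \<in> I \<and> mps_coeff (F i) \<alpha> \<noteq> 0. mps_coeff (F i) \<alpha>)"

text \<open>
  \<open>mps_subst F h\<close> substitutes \<open>T\<^sub>j := h j\<close> in \<open>F\<close>; the \<open>h j\<close> must have zero constant term.
\<close>

definition mps_subst ::
    "('w::finite, 'a::comm_ring_1) mps \<Rightarrow> ('w \<Rightarrow> ('v, 'a) mps) \<Rightarrow> ('v, 'a) mps"
  where "mps_subst F h =
    mps_infsum (\<lambda>\<mu>. mps_const (mps_coeff F \<mu>) * (\<Prod>j\<in>UNIV. h j ^ Poly_Mapping.lookup \<mu> j)) UNIV"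


section \<open>Regular functions on open subsets of affine space\<close>

text \<open>
  The linear order on the index type of the variables is a technical device: the library needs it
  to see that the polynomial ring is a domain.
\<close>

type_synonym ('n, 'k) mpoly = "('n \<Rightarrow>\<^sub>0 nat) \<Rightarrow>\<^sub>0 'k"
type_synonym ('n, 'k) ratfun = "(('n \<Rightarrow>\<^sub>0 nat) \<Rightarrow>\<^sub>0 'k) fract"

definition rat_const :: "'k::field \<Rightarrow> ('n::linorder, 'k) ratfun"
  where "rat_const c = to_fract (Poly_Mapping.single 0 c)"

definition rat_var :: "'n::linorder \<Rightarrow> ('n, 'k::field) ratfun"
  where "rat_var i = to_fract (Poly_Mapping.single (Poly_Mapping.single i 1) 1)"

text \<open>
  Affine space over an arbitrary field is treated as a scheme: its points are the prime ideals of
  the polynomial ring, and open sets are complements of vanishing loci.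
\<close>

definition affine_space :: "('n::linorder, 'k::field) mpoly set set"
  where "affine_space = {P. primeideal P ring_of_type_algebra}"

definition zariski_open :: "('n::linorder, 'k::field) mpoly set set \<Rightarrow> bool"
  where "zariski_open U \<longleftrightarrow> (\<exists>S. U = {P \<in> affine_space. \<not> S \<subseteq> P})"

text \<open>Sections of the structure sheaf, as a subring of the function field.\<close>

definition regular_functions ::
    "('n::linorder, 'k::field) mpoly set set \<Rightarrow> ('n, 'k) ratfun set"
  where "regular_functions U =
    {r. \<forall>P\<in>U. \<exists>a b. b \<notin> P \<and> r = to_fract a / to_fract b}"

definition poly_subst ::
    "('m::finite \<Rightarrow> ('n::linorder, 'k::field) ratfun) \<Rightarrow> ('m, 'k) mpoly \<Rightarrow> ('n, 'k) ratfun"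
  where "poly_subst f q =
    (\<Sum>\<alpha>\<in>Poly_Mapping.keys q. rat_const (Poly_Mapping.lookup q \<alpha>) *
      (\<Prod>j\<in>UNIV. f j ^ Poly_Mapping.lookup \<alpha> j))"

text \<open>
  The image of the point \<open>P\<close> under the morphism given by the tuple \<open>f\<close> of functions regular at \<open>P\<close>:
  the polynomials \<open>q\<close> such that \<open>q(f)\<close> lies in the maximal ideal of the local ring at \<open>P\<close>.
\<close>

definition image_point ::
    "('m::finite \<Rightarrow> ('n::linorder, 'k::field) ratfun) \<Rightarrow> ('n, 'k) mpoly set \<Rightarrow> ('m, 'k) mpoly set"
  where "image_point f P =
    {q. \<exists>a b. a \<in> P \<and> b \<notin> P \<and> poly_subst f q = to_fract a / to_fract b}"

text \<open>
  Substitution \<open>y\<^sub>j := f j\<close> in a rational function. As \<open>f\<close> need not be dominant, the value has to be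
  computed from a representation whose denominator does not become zero. Such a representation exists
  if \<open>r\<close> is regular on an open set containing the image of \<open>f\<close>, and the value does not depend on it.
\<close>

definition pullback ::
    "('m::{finite, linorder} \<Rightarrow> ('n::linorder, 'k::field) ratfun) \<Rightarrow> ('m, 'k) ratfun \<Rightarrow> ('n, 'k) ratfun"
  where "pullback f r =
    (THE s. \<exists>a b. r = to_fract a / to_fract b \<and> poly_subst f b \<noteq> 0 \<and>
      s = poly_subst f a / poly_subst f b)"


section \<open>Higher derivations\<close>

definition higher_derivation :: "'a::comm_ring_1 set \<Rightarrow> ('a \<Rightarrow> ('d, 'a) mps) \<Rightarrow> bool"
  where "higher_derivation R \<theta> \<longleftrightarrow>
    \<theta> \<in> R \<rightarrow> mps_over R \<and>
    \<theta> 1 = 1 \<and>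
    (\<forall>r\<in>R. \<forall>s\<in>R. \<theta> (r + s) = \<theta> r + \<theta> s \<and> \<theta> (r * s) = \<theta> r * \<theta> s) \<and>
    (\<forall>r\<in>R. mps_coeff (\<theta> r) 0 = r)"

text \<open>
  The conditions on constants and variables say that \<open>\<theta>\<close> restricts to the \<open>K\<close>-algebra homomorphism
  on polynomials with \<open>\<theta>(x\<^sub>i) = x\<^sub>i + T\<^sub>i\<close>; this determines \<open>\<theta>\<close> on \<open>regular_functions U\<close>.
\<close>

definition coordinate_higher_derivation ::
    "('n::linorder, 'k::field) mpoly set set \<Rightarrow>
      (('n, 'k) ratfun \<Rightarrow> ('n, ('n, 'k) ratfun) mps) \<Rightarrow> bool"
  where "coordinate_higher_derivation U \<theta> \<longleftrightarrow>
    higher_derivation (regular_functions U) \<theta> \<and>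
    (\<forall>c. \<theta> (rat_const c) = mps_const (rat_const c)) \<and>
    (\<forall>i. \<theta> (rat_var i) = mps_const (rat_var i) + mps_var i)"

end

theory Submission
  imports Defs
begin

text \<open>
  Both sides of the chain rule are ring homomorphisms in the function to be composed with \<open>f\<close>, from
  the regular functions on \<open>V\<close> to power series over \<open>K(x)\<close>, and they agree on constants and on the
  coordinates \<open>y\<^sub>j\<close>, hence on all polynomials. A regular function \<open>r\<close> satisfies \<open>b r = a\<close> with
  polynomials \<open>a\<close>, \<open>b\<close> such that \<open>b(f) \<noteq> 0\<close>. The common image of \<open>b\<close> has the constant term \<open>b(f)\<close>,
  so it is not a zero divisor and can be cancelled.
\<close>

section \<open>Power series in finitely many variables\<close>

lemmas mps_coeff_simps [simp] =
  zero_mps.rep_eq one_mps.rep_eq plus_mps.rep_eq minus_mps.rep_eq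

lemmas mps_coeff_mult = times_mps.rep_eq

lemma mps_coeff_const [simp]: "mps_coeff (mps_const c) \<alpha> = (if \<alpha> = 0 then c else 0)"
  by (simp add: mps_const_def Abs_mps_inverse)

lemma mps_coeff_monom [simp]: "mps_coeff (mps_monom \<nu> c) \<alpha> = (if \<alpha> = \<nu> then c else 0)"
  by (simp add: mps_monom_def Abs_mps_inverse)

lemma mps_coeff_map [simp]: "mps_coeff (mps_map h F) \<alpha> = h (mps_coeff F \<alpha>)"
  by (simp add: mps_map_def Abs_mps_inverse)

lemma mps_coeff_infsum:
  "mps_coeff (mps_infsum F I) \<alpha> = (\<Sum>i | i \<in> I \<and> mps_coeff (F i) \<alpha> \<noteq> 0. mps_coeff (F i) \<alpha>)"
  by (simp add: mps_infsum_def Abs_mps_inverse)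

lemma mps_coeff_sum: "mps_coeff (\<Sum>i\<in>I. F i) \<alpha> = (\<Sum>i\<in>I. mps_coeff (F i) \<alpha>)"
  by (induction I rule: infinite_finite_induct) auto

lemma mps_coeff_const_mult [simp]:
  fixes F :: "('v, 'a::comm_ring_1) mps"
  shows "mps_coeff (mps_const c * F) \<alpha> = c * mps_coeff F \<alpha>"
proof -
  let ?g = "\<lambda>(\<beta> :: 'v \<Rightarrow>\<^sub>0 nat, \<gamma>). mps_coeff (mps_const c) \<beta> * mps_coeff F \<gamma>"
  have "sum ?g {(\<beta>, \<gamma>). \<beta> + \<gamma> = \<alpha>} = sum ?g {(0, \<alpha>)}"
    by (rule sum.mono_neutral_right) (auto simp: finite_antidiagonal split: if_splits)
  then show ?thesis
    by (simp add: mps_coeff_mult)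
qed

lemma mps_const_mult: "mps_const c * mps_const d = mps_const (c * d)"
  by (rule mps_eqI) simp

lemma mps_infsum_monom:
  shows "mps_summable_on (\<lambda>\<nu>. mps_monom \<nu> (c \<nu>)) I"
    and "mps_coeff (mps_infsum (\<lambda>\<nu>. mps_monom \<nu> (c \<nu>)) I) \<alpha> = (if \<alpha> \<in> I then c \<alpha> else 0)"
proof -
  have *: "{\<nu> \<in> I. mps_coeff (mps_monom \<nu> (c \<nu>)) \<alpha> \<noteq> 0} =
      (if \<alpha> \<in> I \<and> c \<alpha> \<noteq> 0 then {\<alpha>} else {})" for \<alpha>
    by auto
  show "mps_summable_on (\<lambda>\<nu>. mps_monom \<nu> (c \<nu>)) I"
    unfolding mps_summable_on_def * by simp
  show "mps_coeff (mps_infsum (\<lambda>\<nu>. mps_monom \<nu> (c \<nu>)) I) \<alpha> = (if \<alpha> \<in> I then c \<alpha> else 0)"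
    unfolding mps_coeff_infsum * by simp
qed

section \<open>Total degree of exponents\<close>

definition multideg :: "('v::finite \<Rightarrow>\<^sub>0 nat) \<Rightarrow> nat"
  where "multideg \<alpha> = (\<Sum>i\<in>UNIV. Poly_Mapping.lookup \<alpha> i)"

lemma multideg_0 [simp]: "multideg 0 = 0"
  by (simp add: multideg_def)

lemma multideg_add [simp]: "multideg (\<alpha> + \<beta>) = multideg \<alpha> + multideg \<beta>"
  by (simp add: multideg_def lookup_add sum.distrib)

lemma multideg_eq_0_iff [simp]: "multideg \<alpha> = 0 \<longleftrightarrow> \<alpha> = 0"
  by (auto simp: multideg_def intro!: poly_mapping_eqI)

text \<open>A bound on the total degree bounds each of the finitely many exponents. Sums over all
  exponents can therefore be cut down to finite ones, degree by degree.\<close>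

lemma finite_multideg_le: "finite {\<mu> :: 'v::finite \<Rightarrow>\<^sub>0 nat. multideg \<mu> \<le> N}"
proof -
  have "finite {h :: 'v \<Rightarrow> nat. \<forall>x. (x \<in> UNIV \<longrightarrow> h x \<in> {..N}) \<and> (x \<notin> UNIV \<longrightarrow> h x = 0)}"
    by (rule finite_set_of_finite_funs) auto
  moreover have "Poly_Mapping.lookup \<mu> x \<le> N" if "multideg \<mu> \<le> N" for \<mu> :: "'v \<Rightarrow>\<^sub>0 nat" and x
    using that member_le_sum[of x UNIV "Poly_Mapping.lookup \<mu>"] by (simp add: multideg_def)
  ultimately have "finite (Poly_Mapping.lookup ` {\<mu> :: 'v \<Rightarrow>\<^sub>0 nat. multideg \<mu> \<le> N})"
    by (rule_tac finite_subset) auto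
  then show ?thesis
    by (rule finite_imageD) (simp add: inj_on_def)
qed

text \<open>In the coefficient of \<open>F * G\<close> at \<alpha>, every term except the constant
  term of \<open>F\<close> times the coefficient of \<open>G\<close> at \<alpha> involves
  \<open>G\<close> in smaller total degree and vanishes by induction. The nonzero constant term then
  cancels in the domain of coefficients.\<close>

lemma mps_mult_eq_0_cancel:
  fixes F G :: "('v::finite, 'a::idom) mps"
  assumes "F * G = 0" and F0: "mps_coeff F 0 \<noteq> 0"
  shows "G = 0"
proof -
  have "mps_coeff G \<alpha> = 0" for \<alpha>
  proof (induction "multideg \<alpha>" arbitrary: \<alpha> rule: less_induct)
    case less
    have "mps_coeff F \<beta> * mps_coeff G \<gamma> = 0" if "\<beta> + \<gamma> = \<alpha>" "(\<beta>, \<gamma>) \<noteq> (0, \<alpha>)" for \<beta> \<gamma>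
    proof -
      have "\<beta> \<noteq> 0"
        using that by auto
      then have "multideg \<gamma> < multideg \<alpha>"
        using zero_less_iff_neq_zero[of "multideg \<beta>"] by (simp flip: that(1))
      then show ?thesis
        by (simp add: less)
    qed
    then have "(\<Sum>(\<beta>, \<gamma>) | \<beta> + \<gamma> = \<alpha>. mps_coeff F \<beta> * mps_coeff G \<gamma>) =
        (\<Sum>(\<beta>, \<gamma>) \<in> {(0, \<alpha>)}. mps_coeff F \<beta> * mps_coeff G \<gamma>)"
      by (intro sum.mono_neutral_right finite_antidiagonal) (auto simp del: mult_eq_0_iff)
    then have "mps_coeff F 0 * mps_coeff G \<alpha> = mps_coeff (F * G) \<alpha>"
      by (simp add: mps_coeff_mult)
    then show ?case
      using assms by simp
  qed
  then show ?thesis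
    by (intro mps_eqI) simp
qed

section \<open>Order of vanishing and power products\<close>

definition mps_order_ge :: "nat \<Rightarrow> ('v::finite, 'a::zero) mps \<Rightarrow> bool"
  where "mps_order_ge n F \<longleftrightarrow> (\<forall>\<alpha>. multideg \<alpha> < n \<longrightarrow> mps_coeff F \<alpha> = 0)"

lemma mps_order_ge_1_iff: "mps_order_ge 1 F \<longleftrightarrow> mps_coeff F 0 = 0"
  by (auto simp: mps_order_ge_def)

lemma mps_order_ge_mult:
  assumes "mps_order_ge m F" "mps_order_ge n G"
  shows "mps_order_ge (m + n) (F * G)"
  unfolding mps_order_ge_def
proof (intro allI impI)
  fix \<alpha> :: "'a \<Rightarrow>\<^sub>0 nat"
  assume \<alpha>: "multideg \<alpha> < m + n"
  have "mps_coeff F \<beta> * mps_coeff G \<gamma> = 0" if "\<beta> + \<gamma> = \<alpha>" for \<beta> \<gamma>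
  proof -
    have "multideg \<beta> < m \<or> multideg \<gamma> < n"
      using \<alpha> by (auto simp flip: that)
    then show ?thesis
      using assms by (auto simp: mps_order_ge_def)
  qed
  then show "mps_coeff (F * G) \<alpha> = 0"
    unfolding mps_coeff_mult by (intro sum.neutral) auto
qed

lemma mps_order_ge_power:
  assumes "mps_order_ge 1 F"
  shows "mps_order_ge k (F ^ k)"
proof (induction k)
  case (Suc k)
  then show ?case
    using mps_order_ge_mult[OF assms Suc] by simp
qed (simp add: mps_order_ge_def)

lemma mps_order_ge_prod:
  assumes "\<And>i. i \<in> I \<Longrightarrow> mps_order_ge (n i) (F i)"
  shows "mps_order_ge (\<Sum>i\<in>I. n i) (\<Prod>i\<in>I. F i)"
  using assms
proof (induction I rule: infinite_finite_induct)
  case (insert i I)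
  then show ?case
    by (simp add: mps_order_ge_mult)
qed (simp_all add: mps_order_ge_def)

text \<open>The multi-index power. Its values lie in an arbitrary commutative monoid, so that it
  serves power series, rational functions and polynomials alike.\<close>

definition mpow :: "('w::finite \<Rightarrow> 'b::comm_monoid_mult) \<Rightarrow> ('w \<Rightarrow>\<^sub>0 nat) \<Rightarrow> 'b"
  where "mpow h \<mu> = (\<Prod>j\<in>UNIV. h j ^ Poly_Mapping.lookup \<mu> j)"

lemma mpow_0 [simp]: "mpow h 0 = 1"
  by (simp add: mpow_def)

lemma mpow_add: "mpow h (\<mu> + \<nu>) = mpow h \<mu> * mpow h \<nu>"
  by (simp add: mpow_def lookup_add power_add prod.distrib)

lemma mpow_single [simp]: "mpow h (Poly_Mapping.single j k) = h j ^ k"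
proof -
  have "mpow h (Poly_Mapping.single j k) = (\<Prod>i\<in>UNIV. if i = j then h j ^ k else 1)"
    unfolding mpow_def by (rule prod.cong) (auto simp: lookup_single when_def)
  then show ?thesis
    by simp
qed

text \<open>Each factor \<open>h j\<close> has order at least 1, and lower bounds for the order add
  up under multiplication.\<close>

lemma mps_order_ge_mpow:
  assumes "\<And>j. mps_coeff (h j) 0 = 0"
  shows "mps_order_ge (multideg \<mu>) (mpow h \<mu>)"
  unfolding multideg_def mpow_def
  using assms mps_order_ge_1_iff by (intro mps_order_ge_prod mps_order_ge_power) blast

lemma mps_coeff_mpow_eq_0:
  assumes "\<And>j. mps_coeff (h j) 0 = 0" and "multideg \<alpha> < multideg \<mu>"
  shows "mps_coeff (mpow h \<mu>) \<alpha> = 0"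
  using mps_order_ge_mpow[of h \<mu>] assms by (simp add: mps_order_ge_def)

section \<open>Substitution of series without constant term\<close>

lemma mps_subst_altdef:
  "mps_subst F h = mps_infsum (\<lambda>\<mu>. mps_const (mps_coeff F \<mu>) * mpow h \<mu>) UNIV"
  by (simp add: mps_subst_def mpow_def)

context
  fixes h :: "'w::finite \<Rightarrow> ('v::finite, 'a::comm_ring_1) mps"
  assumes h0: "\<And>j. mps_coeff (h j) 0 = 0"
begin

lemma mps_summable_on_mpow: "mps_summable_on (\<lambda>\<mu>. mps_const (c \<mu>) * mpow h \<mu>) UNIV"
  unfolding mps_summable_on_def
proof
  fix \<alpha> :: "'v \<Rightarrow>\<^sub>0 nat"
  have "{\<mu> \<in> UNIV. mps_coeff (mps_const (c \<mu>) * mpow h \<mu>) \<alpha> \<noteq> 0} \<subseteq> {\<mu>. multideg \<mu> \<le> multideg \<alpha>}"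
    using mps_coeff_mpow_eq_0[OF h0] by (force simp: not_less[symmetric])
  then show "finite {\<mu> \<in> UNIV. mps_coeff (mps_const (c \<mu>) * mpow h \<mu>) \<alpha> \<noteq> 0}"
    using finite_multideg_le finite_subset by blast
qed

text \<open>Makes substitution accessible through finite sums, since exponents of degree above
  \<open>N\<close> contribute nothing at \<alpha>. The bound may exceed the degree of \<alpha>, so
  that both factors of a product can be truncated at the same degree.\<close>

lemma mps_coeff_subst:
  assumes "multideg \<alpha> \<le> N"
  shows "mps_coeff (mps_subst F h) \<alpha> =
    mps_coeff (\<Sum>\<mu> | multideg \<mu> \<le> N. mps_const (mps_coeff F \<mu>) * mpow h \<mu>) \<alpha>"
  unfolding mps_subst_altdef mps_coeff_infsum mps_coeff_sum
proof (rule sum.mono_neutral_left[OF finite_multideg_le])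
  show "{\<mu> \<in> UNIV. mps_coeff (mps_const (mps_coeff F \<mu>) * mpow h \<mu>) \<alpha> \<noteq> 0}
      \<subseteq> {\<mu>. multideg \<mu> \<le> N}"
  proof clarify
    fix \<mu>
    assume "mps_coeff (mps_const (mps_coeff F \<mu>) * mpow h \<mu>) \<alpha> \<noteq> 0"
    then have "\<not> multideg \<alpha> < multideg \<mu>"
      using mps_coeff_mpow_eq_0[OF h0] by force
    then show "multideg \<mu> \<le> N"
      using assms by simp
  qed
qed auto

lemma mps_subst_add: "mps_subst (F + G) h = mps_subst F h + mps_subst G h"
  by (rule mps_eqI)
    (simp add: mps_coeff_subst[OF order_refl] mps_coeff_sum distrib_right sum.distrib)

text \<open>At a fixed \<alpha> everything is a finite double sum over \<mu> and \<nu>. Collecting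
  the terms with equal \<mu> + \<nu> yields the convolution that defines the coefficients of
  \<open>F * G\<close>.\<close>

lemma mps_subst_mult: "mps_subst (F * G) h = mps_subst F h * mps_subst G h"
proof (rule mps_eqI)
  fix \<alpha> :: "'v \<Rightarrow>\<^sub>0 nat"
  let ?D = "{\<mu> :: 'w \<Rightarrow>\<^sub>0 nat. multideg \<mu> \<le> multideg \<alpha>}"
  let ?S = "\<lambda>F. \<Sum>\<mu>\<in>?D. mps_const (mps_coeff F \<mu>) * mpow h \<mu>"
  let ?t = "\<lambda>\<mu> \<nu>. mps_coeff F \<mu> * mps_coeff G \<nu> * mps_coeff (mpow h (\<mu> + \<nu>)) \<alpha>"
  have le: "multideg \<beta> \<le> multideg \<alpha>" "multideg \<gamma> \<le> multideg \<alpha>" if "\<beta> + \<gamma> = \<alpha>" for \<beta> \<gamma>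
    by (simp_all flip: that)
  have prod: "mps_const (mps_coeff F \<mu>) * mpow h \<mu> * (mps_const (mps_coeff G \<nu>) * mpow h \<nu>) =
      mps_const (mps_coeff F \<mu> * mps_coeff G \<nu>) * mpow h (\<mu> + \<nu>)" for \<mu> \<nu>
    by (simp add: mpow_add mult_ac flip: mps_const_mult)
  have le_of_nonzero: "multideg \<mu> + multideg \<nu> \<le> multideg \<alpha>" if "?t \<mu> \<nu> \<noteq> 0" for \<mu> \<nu>
  proof (rule ccontr)
    assume "\<not> ?thesis"
    then have "?t \<mu> \<nu> = 0"
      by (simp add: mps_coeff_mpow_eq_0[OF h0])
    then show False
      using that by simp
  qed
  have "mps_coeff (mps_subst F h * mps_subst G h) \<alpha> = mps_coeff (?S F * ?S G) \<alpha>"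
    unfolding mps_coeff_mult
    by (rule sum.cong) (auto simp: mps_coeff_subst[OF le(1)] mps_coeff_subst[OF le(2)])
  also have "\<dots> = (\<Sum>\<mu>\<in>?D. \<Sum>\<nu>\<in>?D. ?t \<mu> \<nu>)"
    by (simp add: sum_product prod mps_coeff_sum)
  also have "\<dots> = (\<Sum>(\<mu>, \<nu>)\<in>?D \<times> ?D. ?t \<mu> \<nu>)"
    by (rule sum.cartesian_product)
  \<comment> \<open>The square shrinks to the triangle of total degree at most that of \<alpha>; by
    \<open>le_of_nonzero\<close> the omitted terms are zero.\<close>
  also have "\<dots> = (\<Sum>(\<mu>, \<nu>) | \<mu> + \<nu> \<in> ?D. ?t \<mu> \<nu>)"
    by (rule sum.mono_neutral_right)
      (auto simp: finite_multideg_le dest!: le_of_nonzero)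
  also have "\<dots> = (\<Sum>(\<kappa>, x) \<in> Sigma ?D (\<lambda>\<kappa>. {(\<mu>, \<nu>). \<mu> + \<nu> = \<kappa>}). ?t (fst x) (snd x))"
    by (rule sum.reindex_bij_witness[of _ snd "\<lambda>(\<mu>, \<nu>). (\<mu> + \<nu>, (\<mu>, \<nu>))"]) auto
  also have "\<dots> = (\<Sum>\<kappa>\<in>?D. \<Sum>x \<in> {(\<mu>, \<nu>). \<mu> + \<nu> = \<kappa>}. ?t (fst x) (snd x))"
    by (rule sum.Sigma[symmetric]) (auto simp: finite_multideg_le finite_antidiagonal)
  also have "\<dots> = (\<Sum>\<kappa>\<in>?D. mps_coeff (F * G) \<kappa> * mps_coeff (mpow h \<kappa>) \<alpha>)"
    by (rule sum.cong) (auto simp: mps_coeff_mult case_prod_unfold sum_distrib_right)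
  also have "\<dots> = mps_coeff (mps_subst (F * G) h) \<alpha>"
    by (simp add: mps_coeff_subst[OF order_refl] mps_coeff_sum)
  finally show "mps_coeff (mps_subst (F * G) h) \<alpha> = mps_coeff (mps_subst F h * mps_subst G h) \<alpha>" ..
qed

lemma mps_subst_monom: "mps_subst (mps_monom \<mu> c) h = mps_const c * mpow h \<mu>"
proof (rule mps_eqI)
  fix \<alpha>
  \<comment> \<open>\<open>mps_infsum\<close> ranges over the nonzero terms only, so the index set
    is empty if the one candidate vanishes at \<alpha>.\<close>
  have "{\<nu>. mps_coeff (mps_const (mps_coeff (mps_monom \<mu> c) \<nu>) * mpow h \<nu>) \<alpha> \<noteq> 0} =
    (if c * mps_coeff (mpow h \<mu>) \<alpha> \<noteq> 0 then {\<mu>} else {})"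
    by auto
  then show "mps_coeff (mps_subst (mps_monom \<mu> c) h) \<alpha> = mps_coeff (mps_const c * mpow h \<mu>) \<alpha>"
    unfolding mps_subst_altdef mps_coeff_infsum by simp
qed

lemma mps_subst_const: "mps_subst (mps_const c) h = mps_const c"
  using mps_subst_monom[of 0 c] by (simp add: mps_const_def mps_monom_def)

lemma mps_subst_var: "mps_subst (mps_var j) h = h j"
proof -
  have "mps_const 1 = (1 :: ('v, 'a) mps)"
    by (rule mps_eqI) simp
  then show ?thesis
    by (simp add: mps_var_def mps_subst_monom)
qed

end


section \<open>Homomorphisms on subsemirings\<close>

definition subsemiring :: "'a::comm_ring_1 set \<Rightarrow> bool"
  where "subsemiring R \<longleftrightarrow> 0 \<in> R \<and> 1 \<in> R \<and> (\<forall>r\<in>R. \<forall>s\<in>R. r + s \<in> R \<and> r * s \<in> R)"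

text \<open>Relative to a carrier set, because higher derivations and \<open>pullback\<close> are
  total functions that are known to respect the operations only on regular functions. The value at 0
  follows from additivity by cancellation in the target.\<close>

definition ring_hom_on :: "'a::comm_ring_1 set \<Rightarrow> ('a \<Rightarrow> 'b::comm_ring_1) \<Rightarrow> bool"
  where "ring_hom_on R h \<longleftrightarrow>
    h 1 = 1 \<and> (\<forall>r\<in>R. \<forall>s\<in>R. h (r + s) = h r + h s \<and> h (r * s) = h r * h s)"

lemma ring_hom_on_comp:
  assumes "ring_hom_on R h" "ring_hom_on S k" "h \<in> R \<rightarrow> S"
  shows "ring_hom_on R (\<lambda>r. k (h r))"
  using assms unfolding ring_hom_on_def by (simp add: Pi_iff)

lemma ring_hom_on_0:
  assumes "subsemiring R" "ring_hom_on R h"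
  shows "h 0 = 0"
proof -
  have "h (0 + 0) = h 0 + h 0"
    using assms unfolding ring_hom_on_def subsemiring_def by blast
  then show ?thesis
    by simp
qed

lemma subsemiring_sum:
  assumes "subsemiring R" "\<And>i. i \<in> I \<Longrightarrow> x i \<in> R"
  shows "(\<Sum>i\<in>I. x i) \<in> R"
  using assms(2)
  by (induction I rule: infinite_finite_induct) (use assms(1) in \<open>auto simp: subsemiring_def\<close>)

lemma subsemiring_prod:
  assumes "subsemiring R" "\<And>i. i \<in> I \<Longrightarrow> x i \<in> R"
  shows "(\<Prod>i\<in>I. x i) \<in> R"
  using assms(2)
  by (induction I rule: infinite_finite_induct) (use assms(1) in \<open>auto simp: subsemiring_def\<close>)

lemma subsemiring_power:
  assumes "subsemiring R" "x \<in> R"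
  shows "x ^ k \<in> R"
  by (induction k) (use assms in \<open>auto simp: subsemiring_def\<close>)

lemma ring_hom_on_sum:
  assumes "subsemiring R" "ring_hom_on R h" "\<And>i. i \<in> I \<Longrightarrow> x i \<in> R"
  shows "h (\<Sum>i\<in>I. x i) = (\<Sum>i\<in>I. h (x i))"
  using assms(3)
proof (induction I rule: infinite_finite_induct)
  case (insert i I)
  moreover have "(\<Sum>i\<in>I. x i) \<in> R"
    using insert by (intro subsemiring_sum assms(1)) auto
  ultimately show ?case
    using assms(2) by (simp add: ring_hom_on_def)
qed (simp_all add: ring_hom_on_0[OF assms(1,2)])

text \<open>Each coefficient of a product is a finite sum of products of elements of
  \<open>R\<close>, and \<open>h\<close> passes through it. This handles the coefficientwise
  pullback.\<close>

lemma ring_hom_on_mps_map: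
  assumes "subsemiring R" "ring_hom_on R h"
  shows "ring_hom_on (mps_over R) (mps_map h :: ('v, 'a::comm_ring_1) mps \<Rightarrow> ('v, 'b::comm_ring_1) mps)"
  unfolding ring_hom_on_def
proof (intro conjI ballI)
  show "mps_map h (1 :: ('v, 'a) mps) = 1"
    using assms by (intro mps_eqI) (simp add: ring_hom_on_0 ring_hom_on_def)
next
  fix F G :: "('v, 'a) mps"
  assume FG: "F \<in> mps_over R" "G \<in> mps_over R"
  show "mps_map h (F + G) = mps_map h F + mps_map h G"
    using FG assms(2) by (intro mps_eqI) (simp add: ring_hom_on_def mps_over_def)
  have "mps_coeff F \<beta> * mps_coeff G \<gamma> \<in> R" for \<beta> \<gamma>
    using FG assms(1) by (simp add: subsemiring_def mps_over_def)
  moreover have "h (mps_coeff F \<beta> * mps_coeff G \<gamma>) = h (mps_coeff F \<beta>) * h (mps_coeff G \<gamma>)" for \<beta> \<gamma>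
    using FG assms(2) by (simp add: ring_hom_on_def mps_over_def)
  ultimately show "mps_map h (F * G) = mps_map h F * mps_map h G"
    by (intro mps_eqI) (simp add: mps_coeff_mult ring_hom_on_sum[OF assms] case_prod_unfold)
qed

lemma ring_hom_on_mps_subst:
  fixes h :: "'w::finite \<Rightarrow> ('v::finite, 'a::comm_ring_1) mps"
  assumes "\<And>j. mps_coeff (h j) 0 = 0"
  shows "ring_hom_on UNIV (\<lambda>F. mps_subst F h)"
proof -
  have one: "mps_const 1 = (1 :: ('u, 'a) mps)"
    by (rule mps_eqI) simp
  show ?thesis
    unfolding ring_hom_on_def one[symmetric]
    using assms by (simp add: mps_subst_add mps_subst_mult mps_subst_const)
qed


section \<open>Polynomials and regular functions\<close>

text \<open>A polynomial is the finite sum of its terms.\<close>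

lemma mpoly_induct [case_names single add]:
  fixes p :: "'a \<Rightarrow>\<^sub>0 'b::comm_monoid_add"
  assumes "\<And>\<alpha> c. P (Poly_Mapping.single \<alpha> c)" and "\<And>p q. P p \<Longrightarrow> P q \<Longrightarrow> P (p + q)"
  shows "P p"
proof -
  have "P (\<Sum>\<alpha>\<in>A. Poly_Mapping.single \<alpha> (Poly_Mapping.lookup p \<alpha>))" for A
    \<comment> \<open>The empty sum is covered by a term with coefficient 0 and an arbitrary
      exponent.\<close>
    by (induction A rule: infinite_finite_induct) (use assms assms(1)[of undefined 0] in auto)
  moreover have "(\<Sum>\<alpha>\<in>Poly_Mapping.keys p. Poly_Mapping.single \<alpha> (Poly_Mapping.lookup p \<alpha>)) = p"
    by (rule poly_mapping_eqI) (auto simp: lookup_sum lookup_single when_def in_keys_iff)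
  ultimately show ?thesis
    by metis
qed

lemma rat_const_simps [simp]:
  shows "rat_const 0 = 0" and "rat_const 1 = 1"
    and "rat_const (c + d) = rat_const c + rat_const d"
    and "rat_const (c * d) = rat_const c * rat_const d"
proof -
  show "rat_const (c * d) = rat_const c * rat_const d"
    by (simp add: rat_const_def mult_single flip: to_fract_mult)
qed (simp_all add: rat_const_def single_add)

lemma poly_subst_altdef:
  "poly_subst f q = (\<Sum>\<alpha>\<in>Poly_Mapping.keys q. rat_const (Poly_Mapping.lookup q \<alpha>) * mpow f \<alpha>)"
  by (simp add: poly_subst_def mpow_def)

text \<open>Lets several polynomials be evaluated over one common set of exponents; cancellation can
  make the keys of \<open>p + q\<close> smaller than the union of the keys.\<close>

lemma poly_subst_superset:
  assumes "finite A" "Poly_Mapping.keys q \<subseteq> A"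
  shows "poly_subst f q = (\<Sum>\<alpha>\<in>A. rat_const (Poly_Mapping.lookup q \<alpha>) * mpow f \<alpha>)"
  unfolding poly_subst_altdef using assms
  by (intro sum.mono_neutral_left) (auto simp: in_keys_iff)

lemma poly_subst_single [simp]:
  "poly_subst f (Poly_Mapping.single \<alpha> c) = rat_const c * mpow f \<alpha>"
  using poly_subst_superset[of "{\<alpha>}" "Poly_Mapping.single \<alpha> c" f] by simp

lemma poly_subst_0 [simp]: "poly_subst f 0 = 0"
  by (simp add: poly_subst_def)

lemma poly_subst_1 [simp]: "poly_subst f 1 = 1"
  using poly_subst_single[of f 0 1] by simp

lemma poly_subst_add: "poly_subst f (p + q) = poly_subst f p + poly_subst f q"
proof -
  let ?A = "Poly_Mapping.keys p \<union> Poly_Mapping.keys q"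
  have "Poly_Mapping.keys (p + q) \<subseteq> ?A"
    by (rule keys_add)
  then show ?thesis
    by (simp add: poly_subst_superset[of ?A] lookup_add distrib_right sum.distrib)
qed

lemma poly_subst_mult: "poly_subst f (p * q) = poly_subst f p * poly_subst f q"
proof (induction p rule: mpoly_induct)
  case (single \<alpha> c)
  show ?case
    by (induction q rule: mpoly_induct)
      (simp_all add: mult_single mpow_add poly_subst_add distrib_left distrib_right mult_ac)
next
  case (add p1 p2)
  then show ?case
    by (simp add: poly_subst_add distrib_right)
qed


lemma to_fract_power [simp]: "to_fract (p ^ k) = to_fract p ^ k"
  by (induction k) simp_all

lemma to_fract_prod [simp]: "to_fract (\<Prod>i\<in>I. p i) = (\<Prod>i\<in>I. to_fract (p i))"
  by (induction I rule: infinite_finite_induct) simp_all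

lemma single_eq_mpow:
  "Poly_Mapping.single \<alpha> (1 :: 'a::comm_semiring_1) =
    mpow (\<lambda>i. Poly_Mapping.single (Poly_Mapping.single i 1) 1) (\<alpha> :: 'n::finite \<Rightarrow>\<^sub>0 nat)"
proof -
  have power: "Poly_Mapping.single (Poly_Mapping.single i 1) (1 :: 'a) ^ k =
      Poly_Mapping.single (Poly_Mapping.single i k) 1" for i :: 'n and k
    by (induction k) (simp_all add: mult_single flip: single_add)
  have prod: "(\<Prod>i\<in>I. Poly_Mapping.single (\<beta> i) (1 :: 'a)) =
      Poly_Mapping.single (\<Sum>i\<in>I. \<beta> i) 1" for I and \<beta> :: "'n \<Rightarrow> 'n \<Rightarrow>\<^sub>0 nat"
    by (induction I rule: infinite_finite_induct) (simp_all add: mult_single)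
  have "(\<Sum>i\<in>UNIV. Poly_Mapping.single i (Poly_Mapping.lookup \<alpha> i)) = \<alpha>"
    by (rule poly_mapping_eqI) (simp add: lookup_sum lookup_single when_def)
  then show ?thesis
    by (simp add: mpow_def power[unfolded One_nat_def] prod)
qed

text \<open>The embedding into the function field is the substitution of the coordinates for
  themselves. It exhibits every polynomial as built from constants and coordinates.\<close>

lemma to_fract_eq_poly_subst:
  fixes p :: "('n::{finite, linorder}, 'k::field) mpoly"
  shows "to_fract p = poly_subst rat_var p"
proof (induction p rule: mpoly_induct)
  case (single \<alpha> c)
  have "to_fract (Poly_Mapping.single \<alpha> c) =
      to_fract (Poly_Mapping.single 0 c * Poly_Mapping.single \<alpha> 1)"
    by (simp add: mult_single del: to_fract_mult)
  also have "\<dots> = rat_const c * to_fract (Poly_Mapping.single \<alpha> 1)"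
    by (simp only: rat_const_def to_fract_mult)
  also have "to_fract (Poly_Mapping.single \<alpha> (1 :: 'k)) = mpow rat_var \<alpha>"
    by (subst single_eq_mpow) (simp only: mpow_def rat_var_def to_fract_prod to_fract_power)
  finally show ?case
    by simp
qed (simp add: poly_subst_add)

lemma poly_subst_rat_var:
  "poly_subst f (Poly_Mapping.single (Poly_Mapping.single j 1) 1) = f j"
  by simp

section \<open>Points of affine space and their local rings\<close>

lemma affine_spaceD:
  assumes "P \<in> affine_space"
  shows "0 \<in> P" and "1 \<notin> P" and "a \<notin> P \<Longrightarrow> b \<notin> P \<Longrightarrow> a * b \<notin> P"
proof -
  have P: "primeideal P ring_of_type_algebra"
    using assms by (simp add: affine_space_def)
  then have ideal: "ideal P ring_of_type_algebra"
    by (rule primeideal.axioms)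
  show "0 \<in> P"
    using additive_subgroup.zero_closed[OF ideal.axioms(1)[OF ideal]]
    by (simp add: ring_of_type_algebra_def)
  show "1 \<notin> P"
    using ideal.one_imp_carrier[OF ideal] primeideal.I_notcarr[OF P]
    by (auto simp: ring_of_type_algebra_def)
  show "a * b \<notin> P" if "a \<notin> P" "b \<notin> P"
    using primeideal.I_prime[OF P, of a b] that by (auto simp: ring_of_type_algebra_def)
qed

text \<open>For a point \<open>P\<close> this is its local ring, realised inside the function field.
  Sections over \<open>U\<close> form the intersection of these rings, so they can be studied one
  point at a time.\<close>

definition regular_at ::
    "('n::linorder, 'k::field) mpoly set \<Rightarrow> ('n, 'k) ratfun set"
  where "regular_at P = {r. \<exists>a b. b \<notin> P \<and> r = to_fract a / to_fract b}"

lemma regular_functions_eq: "regular_functions U = (\<Inter>P\<in>U. regular_at P)"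
  by (auto simp: regular_functions_def regular_at_def)

lemma regular_atI: "b \<notin> P \<Longrightarrow> r = to_fract a / to_fract b \<Longrightarrow> r \<in> regular_at P"
  by (auto simp: regular_at_def)

lemma to_fract_in_regular_at: "P \<in> affine_space \<Longrightarrow> to_fract p \<in> regular_at P"
  by (rule regular_atI[of 1]) (simp_all add: affine_spaceD)

text \<open>Sums and products are written over the common denominator \<open>b * d\<close>, which
  stays outside \<open>P\<close> because \<open>P\<close> is prime.\<close>

lemma subsemiring_regular_at:
  assumes P: "P \<in> affine_space"
  shows "subsemiring (regular_at P)"
  unfolding subsemiring_def
proof (intro conjI ballI)
  show "0 \<in> regular_at P" "1 \<in> regular_at P"
    using to_fract_in_regular_at[OF P, of 0] to_fract_in_regular_at[OF P, of 1] by simp_all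
  fix r s
  assume "r \<in> regular_at P" "s \<in> regular_at P"
  then obtain a b c d where rs: "b \<notin> P" "r = to_fract a / to_fract b"
      "d \<notin> P" "s = to_fract c / to_fract d"
    by (auto simp: regular_at_def)
  then have nz: "b \<noteq> 0" "d \<noteq> 0"
    using affine_spaceD(1)[OF P] by auto
  have bd: "b * d \<notin> P"
    using rs affine_spaceD(3)[OF P] by simp
  have "r + s = to_fract (a * d + c * b) / to_fract (b * d)"
    using nz by (simp add: rs add_frac_eq)
  then show "r + s \<in> regular_at P"
    by (rule regular_atI[OF bd])
  have "r * s = to_fract (a * c) / to_fract (b * d)"
    by (simp add: rs)
  then show "r * s \<in> regular_at P"
    by (rule regular_atI[OF bd])
qed

lemma zariski_openD: "zariski_open U \<Longrightarrow> U \<subseteq> affine_space"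
  by (auto simp: zariski_open_def)

lemma subsemiring_regular_functions:
  assumes "U \<subseteq> affine_space"
  shows "subsemiring (regular_functions U)"
proof -
  have "subsemiring (regular_at P)" if "P \<in> U" for P
    using that assms by (intro subsemiring_regular_at) blast
  then show ?thesis
    by (simp add: regular_functions_eq subsemiring_def)
qed

lemma to_fract_in_regular_functions: "U \<subseteq> affine_space \<Longrightarrow> to_fract p \<in> regular_functions U"
  using to_fract_in_regular_at by (auto simp: regular_functions_eq)


section \<open>Pullback along a morphism\<close>

lemma poly_subst_in_regular_at:
  assumes "P \<in> affine_space" "range f \<subseteq> regular_at P"
  shows "poly_subst f q \<in> regular_at P"
proof -
  have R: "subsemiring (regular_at P)"
    by (rule subsemiring_regular_at) fact
  then have mult: "r * s \<in> regular_at P" if "r \<in> regular_at P" "s \<in> regular_at P" for r s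
    using that by (simp add: subsemiring_def)
  then show ?thesis
    unfolding poly_subst_def
    using assms to_fract_in_regular_at[OF assms(1)]
    by (intro subsemiring_sum[OF R] mult subsemiring_prod[OF R] subsemiring_power[OF R])
      (auto simp: rat_const_def)
qed

text \<open>Write \<open>q(f)\<close> as \<open>a / b\<close> with \<open>b\<close> outside
  \<open>P\<close>. If \<open>a\<close> were in \<open>P\<close>, then \<open>q\<close> would belong
  to the image point; hence \<open>a\<close> is outside \<open>P\<close> and \<open>b / a\<close> is
  regular there.\<close>

lemma poly_subst_unit:
  assumes P: "P \<in> affine_space" and f: "range f \<subseteq> regular_at P" and q: "q \<notin> image_point f P"
  shows "poly_subst f q \<noteq> 0" and "inverse (poly_subst f q) \<in> regular_at P"
proof -
  obtain a b where ab: "b \<notin> P" "poly_subst f q = to_fract a / to_fract b"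
    using poly_subst_in_regular_at[OF P f, of q] by (auto simp: regular_at_def)
  then have "a \<notin> P"
    using q by (auto simp: image_point_def)
  then show "poly_subst f q \<noteq> 0" "inverse (poly_subst f q) \<in> regular_at P"
    using ab affine_spaceD(1)[OF P] by (auto simp: intro: regular_atI[of a])
qed

text \<open>Independence of the representation: equal fractions give a polynomial identity after
  cross-multiplication, and substitution preserves it.\<close>

lemma pullback_divide:
  assumes "poly_subst f b \<noteq> 0"
  shows "pullback f (to_fract a / to_fract b) = poly_subst f a / poly_subst f b"
  unfolding pullback_def
proof (rule the_equality)
  fix s
  assume "\<exists>a' b'. to_fract a / to_fract b = to_fract a' / to_fract b' \<and> poly_subst f b' \<noteq> 0 \<and>
    s = poly_subst f a' / poly_subst f b'"
  then obtain a' b' where *: "to_fract a / to_fract b = to_fract a' / to_fract b'"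
      "poly_subst f b' \<noteq> 0" "s = poly_subst f a' / poly_subst f b'"
    by blast
  \<comment> \<open>Substitution sends the zero polynomial to 0, so nonvanishing after substitution
    implies nonvanishing before.\<close>
  moreover have "b \<noteq> 0" "b' \<noteq> 0"
    using assms * by auto
  ultimately have "to_fract (a * b') = to_fract (a' * b)"
    by (simp add: frac_eq_eq)
  then have "poly_subst f (a * b') = poly_subst f (a' * b)"
    by (simp only: to_fract_eq_iff)
  then show "s = poly_subst f a / poly_subst f b"
    using assms * by (simp add: poly_subst_mult frac_eq_eq)
qed (use assms in blast)

lemma pullback_to_fract: "pullback f (to_fract p) = poly_subst f p"
  using pullback_divide[of f 1 p] by simp

lemma pullback_rat_const: "pullback f (rat_const c) = rat_const c"
  unfolding rat_const_def pullback_to_fract by (simp add: rat_const_def)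

lemma pullback_rat_var: "pullback f (rat_var j) = f j"
  unfolding rat_var_def pullback_to_fract poly_subst_rat_var ..

text \<open>A denominator outside the image point becomes a unit of the local ring at
  \<open>P\<close>, so \<open>pullback_divide\<close> applies to this representation.\<close>

lemma regular_at_image_point_cases:
  assumes "r \<in> regular_at (image_point f P)" "P \<in> affine_space" "range f \<subseteq> regular_at P"
  obtains a b where "r = to_fract a / to_fract b" "poly_subst f b \<noteq> 0"
    "inverse (poly_subst f b) \<in> regular_at P"
  using assms(1) poly_subst_unit[OF assms(2,3)] by (auto simp: regular_at_def[of "image_point f P"])

lemma pullback_in_regular_at:
  assumes "r \<in> regular_at (image_point f P)" "P \<in> affine_space" "range f \<subseteq> regular_at P"
  shows "pullback f r \<in> regular_at P"
proof -
  obtain a b where ab: "r = to_fract a / to_fract b" "poly_subst f b \<noteq> 0"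
    "inverse (poly_subst f b) \<in> regular_at P"
    using regular_at_image_point_cases[OF assms] by metis
  then show ?thesis
    using subsemiring_regular_at[OF assms(2)] poly_subst_in_regular_at[OF assms(2,3), of a]
    by (simp add: pullback_divide subsemiring_def divide_inverse[of "poly_subst f a"])
qed

text \<open>For non-dominant \<open>f\<close> there is no such homomorphism on the whole function
  field, hence the restriction to the local ring at one image point. There the common denominator
  \<open>b * d\<close> still has nonzero image, being a product of nonzero elements of a
  field.\<close>

lemma ring_hom_on_pullback:
  assumes P: "P \<in> affine_space" and f: "range f \<subseteq> regular_at P"
  shows "ring_hom_on (regular_at (image_point f P)) (pullback f)"
  unfolding ring_hom_on_def
proof (intro conjI ballI)
  show "pullback f 1 = 1"
    using pullback_to_fract[of f 1] by simp
  fix r s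
  assume "r \<in> regular_at (image_point f P)" "s \<in> regular_at (image_point f P)"
  then obtain a b c d where rs: "r = to_fract a / to_fract b" "poly_subst f b \<noteq> 0"
      "s = to_fract c / to_fract d" "poly_subst f d \<noteq> 0"
    using regular_at_image_point_cases[OF _ P f] by metis
  then have nz: "b \<noteq> 0" "d \<noteq> 0"
    by auto
  have "r + s = to_fract (a * d + c * b) / to_fract (b * d)"
    using nz by (simp add: rs add_frac_eq)
  then show "pullback f (r + s) = pullback f r + pullback f s"
    using rs by (simp add: pullback_divide poly_subst_mult poly_subst_add add_frac_eq
        del: to_fract_mult to_fract_add)
  have "r * s = to_fract (a * c) / to_fract (b * d)"
    by (simp add: rs)
  then show "pullback f (r * s) = pullback f r * pullback f s"
    using rs by (simp add: pullback_divide poly_subst_mult del: to_fract_mult)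
qed


section \<open>The chain rule\<close>

text \<open>Constants and coordinates generate the polynomial ring, so two homomorphisms agreeing on
  them agree on every polynomial.\<close>

lemma ring_hom_on_to_fract_eqI:
  fixes A B :: "('n::{finite, linorder}, 'k::field) ratfun \<Rightarrow> 'b::comm_ring_1"
  assumes R: "subsemiring R" and to_fract: "range to_fract \<subseteq> R"
    and A: "ring_hom_on R A" and B: "ring_hom_on R B"
    and const: "\<And>c. A (rat_const c) = B (rat_const c)"
    and var: "\<And>i. A (rat_var i) = B (rat_var i)"
  shows "A (to_fract p) = B (to_fract p)"
proof -
  have in_R: "to_fract q \<in> R" for q
    using to_fract by auto
  have mult: "A (r * s) = B (r * s)" if "A r = B r" "A s = B s" "r \<in> R" "s \<in> R" for r s
    using that A B by (simp add: ring_hom_on_def)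
  \<comment> \<open>Membership in \<open>R\<close> is carried along in the inductions, because
    \<open>A\<close> and \<open>B\<close> are known to be multiplicative only on
    \<open>R\<close>.\<close>
  have power: "A (rat_var i ^ k) = B (rat_var i ^ k) \<and> rat_var i ^ k \<in> R" for i k
  proof (induction k)
    case 0
    show ?case
      using A B R by (simp add: ring_hom_on_def subsemiring_def)
  next
    case (Suc k)
    have "rat_var i \<in> R"
      by (simp add: rat_var_def in_R)
    then show ?case
      using Suc R mult[of "rat_var i" "rat_var i ^ k"] var by (simp add: subsemiring_def)
  qed
  have prod: "A (\<Prod>i\<in>I. rat_var i ^ k i) = B (\<Prod>i\<in>I. rat_var i ^ k i) \<and>
      (\<Prod>i\<in>I. rat_var i ^ k i) \<in> R" for I :: "'n set" and k
  proof (induction I rule: infinite_finite_induct)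
    case (insert i I)
    then show ?case
      using power[of i "k i"] R mult by (simp add: subsemiring_def)
  qed (use A B R in \<open>simp_all add: ring_hom_on_def subsemiring_def\<close>)
  show ?thesis
  proof (induction p rule: mpoly_induct)
    case (single \<alpha> c)
    have "to_fract (Poly_Mapping.single \<alpha> c) = rat_const c * mpow rat_var \<alpha>"
      by (simp add: to_fract_eq_poly_subst)
    moreover have "rat_const c \<in> R"
      by (simp add: rat_const_def in_R)
    ultimately show ?case
      using prod[of "Poly_Mapping.lookup \<alpha>" UNIV] const by (simp add: mult mpow_def)
  next
    case (add p q)
    then show ?case
      using A B in_R by (simp add: ring_hom_on_def)
  qed
qed

lemma higher_derivation_imp_ring_hom_on: "higher_derivation R \<theta> \<Longrightarrow> ring_hom_on R \<theta>"
  by (simp add: higher_derivation_def ring_hom_on_def)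

lemma ring_hom_on_subset: "ring_hom_on S h \<Longrightarrow> R \<subseteq> S \<Longrightarrow> ring_hom_on R h"
  unfolding ring_hom_on_def by blast

lemma pullback_in_regular_functions:
  assumes "U \<subseteq> affine_space" "range f \<subseteq> regular_functions U" "image_point f ` U \<subseteq> V"
    and "r \<in> regular_functions V"
  shows "pullback f r \<in> regular_functions U"
  unfolding regular_functions_eq
proof
  fix P
  assume "P \<in> U"
  then show "pullback f r \<in> regular_at P"
    using assms by (intro pullback_in_regular_at) (auto simp: regular_functions_eq)
qed

context
  fixes U :: "('n::{finite, linorder}, 'k::field) mpoly set set"
    and V :: "('m::{finite, linorder}, 'k) mpoly set set"
    and f :: "'m \<Rightarrow> ('n, 'k) ratfun"
    and \<theta>x :: "('n, 'k) ratfun \<Rightarrow> ('n, ('n, 'k) ratfun) mps"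
    and \<theta>y :: "('m, 'k) ratfun \<Rightarrow> ('m, ('m, 'k) ratfun) mps"
  assumes U: "U \<subseteq> affine_space" "U \<noteq> {}" and V: "V \<subseteq> affine_space"
    and f: "range f \<subseteq> regular_functions U" and fV: "image_point f ` U \<subseteq> V"
    and \<theta>x: "coordinate_higher_derivation U \<theta>x"
    and \<theta>y: "coordinate_higher_derivation V \<theta>y"
begin

text \<open>A higher derivation reproduces its argument as constant term. This makes the increments
  admissible for \<open>mps_subst\<close>.\<close>

lemma chain_rule_increment: "mps_coeff (\<theta>x (f j) - mps_const (f j)) 0 = 0"
proof -
  have "f j \<in> regular_functions U"
    using f by blast
  then show ?thesis
    using \<theta>x by (simp add: coordinate_higher_derivation_def higher_derivation_def)
qed

lemma higher_derivation_pullback: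
  assumes r: "r \<in> regular_functions V"
  shows "\<theta>x (pullback f r) =
    mps_subst (mps_map (pullback f) (\<theta>y r)) (\<lambda>j. \<theta>x (f j) - mps_const (f j))"
proof -
  let ?R = "regular_functions V" and ?h = "\<lambda>j. \<theta>x (f j) - mps_const (f j)"
  define A where "A = (\<lambda>r. \<theta>x (pullback f r))"
  define B where "B = (\<lambda>r. mps_subst (mps_map (pullback f) (\<theta>y r)) ?h)"
  \<comment> \<open>One point of \<open>U\<close> suffices: the local ring at its image contains all
    regular functions on \<open>V\<close>, which makes \<open>pullback f\<close> a homomorphism on
    \<open>?R\<close> and supplies a denominator of \<open>r\<close> with \<open>b(f)\<close>
    nonzero.\<close>
  obtain P where P: "P \<in> U"
    using U(2) by blast
  have P_aff: "P \<in> affine_space" and f_at: "range f \<subseteq> regular_at P"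
    and sub: "?R \<subseteq> regular_at (image_point f P)"
    using P U(1) f fV by (auto simp: regular_functions_eq)
  have R: "subsemiring ?R"
    by (rule subsemiring_regular_functions[OF V])
  have pullback: "ring_hom_on ?R (pullback f)"
    by (rule ring_hom_on_subset[OF ring_hom_on_pullback[OF P_aff f_at] sub])
  have \<theta>y_mem: "\<theta>y \<in> ?R \<rightarrow> mps_over ?R" and \<theta>y_hom: "ring_hom_on ?R \<theta>y"
    and \<theta>x_hom: "ring_hom_on (regular_functions U) \<theta>x"
    using \<theta>x \<theta>y higher_derivation_imp_ring_hom_on
    by (auto simp: coordinate_higher_derivation_def higher_derivation_def)
  have A: "ring_hom_on ?R A"
    unfolding A_def using pullback_in_regular_functions[OF U(1) f fV]
    by (intro ring_hom_on_comp[OF pullback \<theta>x_hom]) blast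
  \<comment> \<open>\<open>B\<close> is a composite of three homomorphisms:
    \<open>\<theta>y\<close>, the coefficientwise pullback, and the substitution of the
    increments.\<close>
  have "ring_hom_on ?R (\<lambda>r. mps_map (pullback f) (\<theta>y r))"
    by (rule ring_hom_on_comp[OF \<theta>y_hom ring_hom_on_mps_map[OF R pullback] \<theta>y_mem])
  then have B: "ring_hom_on ?R B"
    unfolding B_def
    by (rule ring_hom_on_comp[OF _ ring_hom_on_mps_subst[of ?h, OF chain_rule_increment]]) blast
  have pullback_0: "pullback f 0 = 0" and pullback_1: "pullback f 1 = 1"
    using ring_hom_on_0[OF R pullback] pullback by (auto simp: ring_hom_on_def)
  have map_const: "mps_map (pullback f) (mps_const c) = mps_const (pullback f c)" for c
    by (rule mps_eqI) (simp add: pullback_0)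
  have const: "A (rat_const c) = B (rat_const c)" for c
    using \<theta>x \<theta>y mps_subst_const[of ?h, OF chain_rule_increment]
    by (simp add: A_def B_def coordinate_higher_derivation_def pullback_rat_const map_const)
  \<comment> \<open>The series of \<open>y_j\<close> is \<open>y_j + T_j\<close>; pullback and
    substitution turn it into \<open>f j\<close> plus the increment of \<open>f j\<close>, which is
    \<open>\<theta>x (f j)\<close>.\<close>
  have var: "A (rat_var j) = B (rat_var j)" for j
  proof -
    have nz: "Poly_Mapping.single j (1 :: nat) \<noteq> 0"
      by (metis lookup_single_eq lookup_zero zero_neq_one)
    have "mps_map (pullback f) (mps_const (rat_var j) + mps_var j) = mps_const (f j) + mps_var j"
      using nz by (intro mps_eqI) (auto simp: mps_var_def pullback_0 pullback_1 pullback_rat_var)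
    then have "B (rat_var j) = mps_subst (mps_const (f j) + mps_var j) ?h"
      using \<theta>y by (simp add: B_def coordinate_higher_derivation_def)
    also have "\<dots> = mps_const (f j) + ?h j"
      by (simp only: mps_subst_add[of ?h, OF chain_rule_increment]
          mps_subst_const[of ?h, OF chain_rule_increment]
          mps_subst_var[of ?h, OF chain_rule_increment])
    finally show ?thesis
      by (simp add: A_def pullback_rat_var)
  qed
  have poly: "A (to_fract p) = B (to_fract p)" for p
    using to_fract_in_regular_functions[OF V]
    by (intro ring_hom_on_to_fract_eqI[OF R _ A B const var]) blast
  have "r \<in> regular_at (image_point f P)"
    using r sub by blast
  then obtain a b where ab: "r = to_fract a / to_fract b" "poly_subst f b \<noteq> 0"
    by (rule regular_at_image_point_cases[OF _ P_aff f_at])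
  have "b \<noteq> 0"
    using ab(2) by auto
  then have br: "to_fract b * r = to_fract a"
    by (simp add: ab(1))
  have "A (to_fract b * r) = A (to_fract b) * A r" "B (to_fract b * r) = B (to_fract b) * B r"
    using A B r to_fract_in_regular_functions[OF V, of b] by (simp_all add: ring_hom_on_def)
  then have "A (to_fract b) * (A r - B r) = 0"
    by (simp add: br poly right_diff_distrib)
  moreover have "mps_coeff (A (to_fract b)) 0 \<noteq> 0"
  proof -
    \<comment> \<open>The constant term of \<open>\<theta>x\<close> is prescribed on regular
      functions on \<open>U\<close>, so membership comes first.\<close>
    have "pullback f (to_fract b) \<in> regular_functions U"
      by (rule pullback_in_regular_functions[OF U(1) f fV to_fract_in_regular_functions[OF V]])
    then have "mps_coeff (A (to_fract b)) 0 = poly_subst f b"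
      using \<theta>x by (simp add: A_def coordinate_higher_derivation_def higher_derivation_def
          pullback_to_fract)
    then show ?thesis
      using ab(2) by simp
  qed
  ultimately have "A r - B r = 0"
    by (rule mps_mult_eq_0_cancel)
  then show ?thesis
    by (simp add: A_def B_def)
qed

end

text \<open>Summability is asserted along with the equations, since a value of
  \<open>mps_infsum\<close> is meaningful only for summable families. The first conjunct places the
  common value over the regular functions on \<open>U\<close> rather than merely over the function
  field.\<close>

theorem theorem3p1:
  fixes U :: "('n::{finite, linorder}, 'k::field) mpoly set set"
    and V :: "('m::{finite, linorder}, 'k) mpoly set set"
    and f :: "'m \<Rightarrow> ('n, 'k) ratfun"
    and g :: "'l::finite \<Rightarrow> ('m, 'k) ratfun"
    and \<theta>x :: "('n, 'k) ratfun \<Rightarrow> ('n, ('n, 'k) ratfun) mps"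
    and \<theta>y :: "('m, 'k) ratfun \<Rightarrow> ('m, ('m, 'k) ratfun) mps"
  assumes "zariski_open U" and "U \<noteq> {}"
    and "zariski_open V" and "V \<noteq> {}"
    and "\<forall>j. f j \<in> regular_functions U"
    and "\<forall>i. g i \<in> regular_functions V"
    and "image_point f ` U \<subseteq> V"
    and "coordinate_higher_derivation U \<theta>x"
    and "coordinate_higher_derivation V \<theta>y"
  shows "(\<forall>i. \<theta>x (pullback f (g i)) \<in> mps_over (regular_functions U)) \<and>
    (\<lambda>i. \<theta>x (pullback f (g i))) =
      (\<lambda>i. mps_subst (mps_map (pullback f) (\<theta>y (g i))) (\<lambda>j. \<theta>x (f j) - mps_const (f j))) \<and>
    (\<forall>j. mps_summable_on (\<lambda>\<nu>. mps_monom \<nu> (mps_coeff (\<theta>x (f j)) \<nu>)) {\<nu>. \<nu> \<noteq> 0}) \<and>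
    (\<forall>i. mps_summable_on
      (\<lambda>\<mu>. mps_const (pullback f (mps_coeff (\<theta>y (g i)) \<mu>)) *
        (\<Prod>j\<in>UNIV. (mps_infsum (\<lambda>\<nu>. mps_monom \<nu> (mps_coeff (\<theta>x (f j)) \<nu>)) {\<nu>. \<nu> \<noteq> 0})
          ^ Poly_Mapping.lookup \<mu> j)) UNIV) \<and>
    (\<lambda>i. mps_subst (mps_map (pullback f) (\<theta>y (g i))) (\<lambda>j. \<theta>x (f j) - mps_const (f j))) =
      (\<lambda>i. mps_infsum
        (\<lambda>\<mu>. mps_const (pullback f (mps_coeff (\<theta>y (g i)) \<mu>)) *
          (\<Prod>j\<in>UNIV. (mps_infsum (\<lambda>\<nu>. mps_monom \<nu> (mps_coeff (\<theta>x (f j)) \<nu>)) {\<nu>. \<nu> \<noteq> 0})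
            ^ Poly_Mapping.lookup \<mu> j)) UNIV)"
proof -
  have U: "U \<subseteq> affine_space" and V: "V \<subseteq> affine_space" and f: "range f \<subseteq> regular_functions U"
    using assms by (auto dest: zariski_openD)
  note ctxt = U \<open>U \<noteq> {}\<close> V f \<open>image_point f ` U \<subseteq> V\<close>
    \<open>coordinate_higher_derivation U \<theta>x\<close> \<open>coordinate_higher_derivation V \<theta>y\<close>
  \<comment> \<open>Dropping the exponent 0 from \<open>\<theta>x (f j)\<close> removes exactly its
    constant term \<open>f j\<close>. With this rewriting the explicit double series becomes the
    definition of \<open>mps_subst\<close>.\<close>
  have increment: "mps_infsum (\<lambda>\<nu>. mps_monom \<nu> (mps_coeff (\<theta>x (f j)) \<nu>)) {\<nu>. \<nu> \<noteq> 0} =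
      \<theta>x (f j) - mps_const (f j)" for j
    using chain_rule_increment[OF ctxt, of j] by (intro mps_eqI) (auto simp: mps_infsum_monom)
  have over: "\<theta>x (pullback f (g i)) \<in> mps_over (regular_functions U)" for i
    using assms pullback_in_regular_functions[OF U f, of V "g i"]
    by (auto simp: coordinate_higher_derivation_def higher_derivation_def)
  have chain: "\<theta>x (pullback f (g i)) =
      mps_subst (mps_map (pullback f) (\<theta>y (g i))) (\<lambda>j. \<theta>x (f j) - mps_const (f j))" for i
    using assms by (intro higher_derivation_pullback[OF ctxt]) blast
  have summable: "mps_summable_on (\<lambda>\<mu>. mps_const (c \<mu>) *
      (\<Prod>j\<in>UNIV. (\<theta>x (f j) - mps_const (f j)) ^ Poly_Mapping.lookup \<mu> j)) UNIV" for c
    unfolding mpow_def[symmetric]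
    by (rule mps_summable_on_mpow) (rule chain_rule_increment[OF ctxt])
  show ?thesis
    unfolding increment
    using over chain summable by (simp add: mps_infsum_monom(1) mps_subst_def)
qed

end
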